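(* Let $\alpha>0$, $A\ge0$, $B>0$, $t>0$, and let $P_n(x,t)$ be the monic polynomials orthogonal on $[0,\infty)$ w.r.t. $w(x,t)=x^\alpha e^{-x}(A+B\theta(x-t))$, with norms $h_n(t)$ and recurrence $zP_n=P_{n+1}+\alpha_n(t)P_n+\beta_n(t)P_{n-1}$. Let $R_n(t)=Bt^\alpha e^{-t}\{P_n(t,t)\}^2/h_n(t)$. Then for $n\ge1$ the function $S_n(t):=1-1/R_n(t)$ satisfies $$S_n''=\frac{3S_n-1}{2S_n(S_n-1)}(S_n')^2-\frac{S_n'}{t}-\frac{\alpha^2}{2}\frac{(S_n-1)^2}{t^2S_n}+(2n+1+\alpha)\frac{S_n}{t}-\frac12\frac{S_n(S_n+1)}{S_n-1},$$ i.e. the fifth Painlev\'e equation $P_V(0,-\alpha^2/2,2n+1+\alpha,-1/2)$, and $$S_n(t)=\frac{\alpha_n(t)-(2n+\alpha+1)-t}{\alpha_n(t)-(2n+\alpha+1)}.$$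
   Context: $\theta$ is the Heaviside function ($1$ for $x>0$, $0$ otherwise); $P_n(t,t)$ is $P_n(x,t)$ at $x=t$; primes denote $d/dt$. The fifth Painlev\'e equation $P_V(a,b,c,d)$ is $y''=\left(\frac{1}{2y}+\frac{1}{y-1}\right)(y')^2-\frac{y'}{t}+\frac{(y-1)^2}{t^2}\left(ay+\frac{b}{y}\right)+c\frac{y}{t}+d\frac{y(y+1)}{y-1}$. *)

theory Defs
  imports "HOL-Analysis.Analysis" "HOL-Computational_Algebra.Polynomial"
begin

definition weight :: "real \<Rightarrow> real \<Rightarrow> real \<Rightarrow> real \<Rightarrow> real \<Rightarrow> real" where
  "weight a A B t x = x powr a * exp (- x) * (A + B * (if x - t > 0 then 1 else 0))"

definition ip :: "real \<Rightarrow> real \<Rightarrow> real \<Rightarrow> real \<Rightarrow> real poly \<Rightarrow> real poly \<Rightarrow> real" where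
  "ip a A B t p q = (LINT x:{0..}|lborel. poly p x * poly q x * weight a A B t x)"

definition is_monic_OP :: "real \<Rightarrow> real \<Rightarrow> real \<Rightarrow> real \<Rightarrow> nat \<Rightarrow> real poly \<Rightarrow> bool" where
  "is_monic_OP a A B t n p \<longleftrightarrow>
     degree p = n \<and> lead_coeff p = 1 \<and> (\<forall>k<n. ip a A B t p (monom 1 k) = 0)"

definition OP :: "real \<Rightarrow> real \<Rightarrow> real \<Rightarrow> real \<Rightarrow> nat \<Rightarrow> real poly" where
  "OP a A B t n = (THE p. is_monic_OP a A B t n p)"

definition hn :: "real \<Rightarrow> real \<Rightarrow> real \<Rightarrow> nat \<Rightarrow> real \<Rightarrow> real" where
  "hn a A B n t = ip a A B t (OP a A B t n) (OP a A B t n)"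

text \<open>alpha_n(t): the coefficient in z P_n = P_(n+1) + alpha_n P_n + beta_n P_(n-1)  (n \<ge> 1).\<close>
definition alphan :: "real \<Rightarrow> real \<Rightarrow> real \<Rightarrow> nat \<Rightarrow> real \<Rightarrow> real" where
  "alphan a A B n t = (THE c. \<exists>b. [:0, 1:] * OP a A B t n
      = OP a A B t (Suc n) + smult c (OP a A B t n) + smult b (OP a A B t (n - 1)))"

definition Rn :: "real \<Rightarrow> real \<Rightarrow> real \<Rightarrow> nat \<Rightarrow> real \<Rightarrow> real" where
  "Rn a A B n t = B * t powr a * exp (- t) * (poly (OP a A B t n) t)\<^sup>2 / hn a A B n t"

definition Sn :: "real \<Rightarrow> real \<Rightarrow> real \<Rightarrow> nat \<Rightarrow> real \<Rightarrow> real" where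
  "Sn a A B n t = 1 - 1 / Rn a A B n t"

end

theory Submission
  imports Defs
begin

text \<open>
  Write \<open>w\<close> for the weight, \<open>L p = \<integral> p w\<close>, \<open>k = B t\<^sup>a e\<^sup>-\<^sup>t\<close> for its jump at \<open>t\<close>, \<open>h\<^sub>n = L (P\<^sub>n\<^sup>2)\<close>, and
  \<open>G\<^sub>n = \<beta>\<^sub>n P\<^sub>n\<^sub>-\<^sub>1\<close>.  Integrating \<open>(x p x\<^sup>a e\<^sup>-\<^sup>x)'\<close> gives the Stein identity
  \<open>L (x p' + (a + 1) p - x p) = - t k p(t)\<close>, while \<open>d/dt L p = - k p(t)\<close> for fixed \<open>p\<close>.
  The boundary terms cancel in \<open>(x \<partial>\<^sub>x + t \<partial>\<^sub>t) P\<^sub>n\<close>, which is therefore \<open>n P\<^sub>n + G\<^sub>n\<close>.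
  With \<open>R = k P\<^sub>n(t)\<^sup>2 / h\<^sub>n\<close>, \<open>r = k P\<^sub>n(t) G\<^sub>n(t) / h\<^sub>n\<close> and \<open>X = k G\<^sub>n(t)\<^sup>2 / h\<^sub>n\<close> this yields
  \<open>\<alpha>\<^sub>n = 2n + 1 + a + t R\<close> and the system
  \<open>t R' = (a - t + 2n + t R) R + 2 r\<close>, \<open>t r' = X - \<beta>\<^sub>n R\<close>.  The system is closed by
  \<open>X R = r\<^sup>2\<close> and by \<open>n (n + a) + (2n + a) r + X = \<beta>\<^sub>n (1 - R)\<close>, which follows by induction on \<open>n\<close>
  from the three-term recurrence.  Eliminating \<open>r\<close>, \<open>X\<close> and \<open>\<beta>\<^sub>n\<close> gives the equation for \<open>1 - 1 / R\<close>.
\<close>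

section \<open>Orthogonal polynomials of a positive functional\<close>

text \<open>Unlike \<open>degree q < n\<close>, this admits the zero polynomial for every
  \<open>n\<close>, also for \<open>n = 0\<close>, so the polynomials concerned form a linear
  space.\<close>

definition deg_lt :: "'a::zero poly \<Rightarrow> nat \<Rightarrow> bool" where
  "deg_lt q n \<longleftrightarrow> (\<forall>i\<ge>n. coeff q i = 0)"

lemma deg_lt_0_iff: "deg_lt q 0 \<longleftrightarrow> q = 0"
  by (auto simp: deg_lt_def poly_eq_iff)

lemma deg_lt_monom: "k < n \<Longrightarrow> deg_lt (monom c k) n"
  by (auto simp: deg_lt_def)

lemma deg_lt_mono: "deg_lt q m \<Longrightarrow> m \<le> n \<Longrightarrow> deg_lt q n"
  by (auto simp: deg_lt_def)

lemma deg_lt_add: "deg_lt p n \<Longrightarrow> deg_lt q n \<Longrightarrow> deg_lt (p + q) n"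
  for p q :: "'a::comm_monoid_add poly"
  by (auto simp: deg_lt_def)

lemma deg_lt_diff: "deg_lt p n \<Longrightarrow> deg_lt q n \<Longrightarrow> deg_lt (p - q) n"
  for p q :: "'a::ab_group_add poly"
  by (auto simp: deg_lt_def)

lemma deg_lt_smult: "deg_lt p n \<Longrightarrow> deg_lt (smult c p) n"
  for c :: "'a::comm_semiring_0"
  by (auto simp: deg_lt_def)

lemma deg_lt_pCons: "deg_lt p n \<Longrightarrow> deg_lt (pCons c p) (Suc n)"
  by (auto simp: deg_lt_def coeff_pCons split: nat.splits)

lemma deg_lt_X_pderiv: "deg_lt p n \<Longrightarrow> deg_lt (pCons 0 (pderiv p)) n"
  for p :: "'a::{comm_semiring_1,semiring_no_zero_divisors} poly"
  by (auto simp: deg_lt_def coeff_pCons coeff_pderiv split: nat.splits)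

lemma coeff_X_pderiv: "coeff (pCons 0 (pderiv p)) i = of_nat i * coeff p i"
  for p :: "'a::{comm_semiring_1,semiring_no_zero_divisors} poly"
  by (auto simp: coeff_pCons coeff_pderiv split: nat.splits)

text \<open>The second component is \<open>\<beta>\<^sub>n P\<^sub>n\<^sub>-\<^sub>1\<close>, which makes sense (as \<open>0\<close>) also for \<open>n = 0\<close>.\<close>

primrec op_pair :: "(real poly \<Rightarrow> real) \<Rightarrow> nat \<Rightarrow> real poly \<times> real poly" where
  "op_pair L 0 = (1, 0)"
| "op_pair L (Suc n) =
    (let P = fst (op_pair L n);
         P' = pCons 0 P - smult (L (pCons 0 (P * P)) / L (P * P)) P - snd (op_pair L n)
     in (P', smult (L (P' * P') / L (P * P)) P))"

definition mop :: "(real poly \<Rightarrow> real) \<Rightarrow> nat \<Rightarrow> real poly" where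
  "mop L n = fst (op_pair L n)"

definition mopG :: "(real poly \<Rightarrow> real) \<Rightarrow> nat \<Rightarrow> real poly" where
  "mopG L n = snd (op_pair L n)"

definition mnorm :: "(real poly \<Rightarrow> real) \<Rightarrow> nat \<Rightarrow> real" where
  "mnorm L n = L (mop L n * mop L n)"

definition malpha :: "(real poly \<Rightarrow> real) \<Rightarrow> nat \<Rightarrow> real" where
  "malpha L n = L (pCons 0 (mop L n * mop L n)) / mnorm L n"

text \<open>The value 0 at \<open>n = 0\<close> matches \<open>mopG L 0 = 0\<close> and lets the
  later identities start at \<open>n = 0\<close>.\<close>

definition mbeta :: "(real poly \<Rightarrow> real) \<Rightarrow> nat \<Rightarrow> real" where
  "mbeta L n = (if n = 0 then 0 else mnorm L n / mnorm L (n - 1))"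

lemma mop_0 [simp]: "mop L 0 = 1" and mopG_0 [simp]: "mopG L 0 = 0"
  by (simp_all add: mop_def mopG_def)

lemma mbeta_0 [simp]: "mbeta L 0 = 0" and mbeta_Suc: "mbeta L (Suc n) = mnorm L (Suc n) / mnorm L n"
  by (simp_all add: mbeta_def)

lemma mop_Suc: "mop L (Suc n) = pCons 0 (mop L n) - smult (malpha L n) (mop L n) - mopG L n"
  by (simp add: mop_def mopG_def malpha_def mnorm_def Let_def)

lemma mopG_Suc: "mopG L (Suc n) = smult (mbeta L (Suc n)) (mop L n)"
  by (simp add: mop_def mopG_def mbeta_def mnorm_def Let_def)

text \<open>Bundled into one induction, since the recursion for each component draws on the bounds
  for the other.\<close>

lemma deg_lt_mop_G: "deg_lt (mop L n) (Suc n) \<and> deg_lt (mopG L n) n \<and> coeff (mop L n) n = 1"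
proof (induction n)
  case 0
  show ?case by (auto simp: deg_lt_def coeff_1)
next
  case (Suc n)
  then have "deg_lt (mop L (Suc n)) (Suc (Suc n))"
    unfolding mop_Suc
    by (intro deg_lt_diff deg_lt_pCons deg_lt_smult) (auto intro: deg_lt_mono)
  moreover have "coeff (mop L (Suc n)) (Suc n) = 1"
    using Suc by (simp add: mop_Suc deg_lt_def)
  ultimately show ?case using Suc by (simp add: mopG_Suc deg_lt_smult)
qed

lemmas deg_lt_mop = deg_lt_mop_G[THEN conjunct1]
  and deg_lt_mopG = deg_lt_mop_G[THEN conjunct2, THEN conjunct1]
  and coeff_mop_top [simp] = deg_lt_mop_G[THEN conjunct2, THEN conjunct2]

lemma mop_nonzero: "mop L n \<noteq> 0"
  using coeff_mop_top[of L n] by (metis coeff_0 zero_neq_one)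

lemma degree_mop [simp]: "degree (mop L n) = n"
proof (rule antisym)
  show "degree (mop L n) \<le> n" using deg_lt_mop[of L n] by (auto simp: deg_lt_def intro: degree_le)
  show "n \<le> degree (mop L n)" by (rule le_degree) simp
qed

text \<open>Serves in place of an expansion in the orthogonal basis: one leading multiple is split
  off at a time.\<close>

lemma split_off_mop:
  assumes "deg_lt q (Suc n)"
  obtains s where "q = smult (coeff q n) (mop L n) + s" "deg_lt s n"
proof
  show "q = smult (coeff q n) (mop L n) + (q - smult (coeff q n) (mop L n))" by simp
  show "deg_lt (q - smult (coeff q n) (mop L n)) n"
    unfolding deg_lt_def
  proof (intro allI impI)
    fix i assume "n \<le> i"
    then show "coeff (q - smult (coeff q n) (mop L n)) i = 0"
      using assms deg_lt_mop[of L n] by (cases "i = n") (auto simp: deg_lt_def)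
  qed
qed

text \<open>Linearity and positivity on squares suffice for the algebra of orthogonal polynomials;
  integrals enter only with the concrete weight.\<close>

locale pos_functional =
  fixes L :: "real poly \<Rightarrow> real"
  assumes L_add: "L (p + q) = L p + L q"
    and L_smult: "L (smult c p) = c * L p"
    and L_pos: "p \<noteq> 0 \<Longrightarrow> L (p * p) > 0"
begin

lemma L_0 [simp]: "L 0 = 0"
  using L_smult[of 0 0] by simp

lemma L_minus: "L (- p) = - L p"
  using L_smult[of "-1" p] by simp

lemma L_diff: "L (p - q) = L p - L q"
  using L_add[of p "- q"] by (simp add: L_minus)

lemmas L_linear = L_add L_diff L_smult

lemma mnorm_pos: "mnorm L n > 0"
  unfolding mnorm_def by (rule L_pos[OF mop_nonzero])

lemma L_X_mop_mop: "L (pCons 0 (mop L n * mop L n)) = malpha L n * mnorm L n"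
  using mnorm_pos[of n] by (simp add: malpha_def)

text \<open>The second part says that \<open>mopG L n\<close> represents the map from
  \<open>q\<close> to \<open>L (pCons 0 (mop L n * q))\<close> on degrees below \<open>n\<close>. It
  makes the next polynomial orthogonal to these degrees, and that orthogonality gives the second
  part at the next index.\<close>

lemma mop_orth_G: "(\<forall>q. deg_lt q n \<longrightarrow> L (mop L n * q) = 0) \<and>
    (\<forall>q. deg_lt q n \<longrightarrow> L (mopG L n * q) = L (pCons 0 (mop L n * q)))"
proof (induction n)
  case 0
  show ?case by (simp add: deg_lt_0_iff)
next
  case (Suc n)
  have orth: "L (mop L (Suc n) * q) = 0" if low: "deg_lt q (Suc n)" for q
  proof -
    obtain s where s: "q = smult (coeff q n) (mop L n) + s" "deg_lt s n"
      using split_off_mop[OF low] by blast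
    \<comment> \<open>The definition of \<open>malpha\<close> makes its term cancel the one from
      multiplication by x.\<close>
    have "L (mop L (Suc n) * mop L n) = - L (mopG L n * mop L n)"
      by (simp add: mop_Suc left_diff_distrib L_linear L_X_mop_mop)
         (simp add: mnorm_def)
    also have "L (mopG L n * mop L n) = 0"
      using Suc deg_lt_mopG[of L n] by (metis mult.commute)
    finally have 1: "L (mop L (Suc n) * mop L n) = 0" by simp
    \<comment> \<open>Here the second induction hypothesis cancels the x-multiple against
      \<open>mopG\<close>.\<close>
    have 2: "L (mop L (Suc n) * s) = 0"
      using Suc s(2) by (simp add: mop_Suc left_diff_distrib L_linear)
    show ?thesis
      by (subst s(1)) (simp add: distrib_left L_linear 1 2)
  qed
  have "L (mopG L (Suc n) * q) = L (pCons 0 (mop L (Suc n) * q))" if low: "deg_lt q (Suc n)" for q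
  proof -
    obtain s where s: "q = smult (coeff q n) (mop L n) + s" "deg_lt s n"
      using split_off_mop[OF low] by blast
    have ls: "L (mop L n * s) = 0" using Suc s(2) by simp
    have "L (mopG L (Suc n) * q) = mbeta L (Suc n) * L (mop L n * q)"
      by (simp add: mopG_Suc L_linear)
    also have "L (mop L n * q) = coeff q n * mnorm L n"
      by (subst s(1)) (simp add: distrib_left L_linear ls mnorm_def)
    finally have 1: "L (mopG L (Suc n) * q) = mnorm L (Suc n) * coeff q n"
      using mnorm_pos[of n] by (simp add: mbeta_Suc)
    have "pCons 0 (mop L (Suc n) * q) = mop L (Suc n) * pCons 0 q" by simp
    \<comment> \<open>Only the leading multiple of \<open>mop L (Suc n)\<close> survives; the rest
      has degree at most \<open>n\<close> and is removed by \<open>orth\<close>.\<close>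
    also have "pCons 0 q = smult (coeff q n) (mop L (Suc n)) +
        (smult (coeff q n) (smult (malpha L n) (mop L n) + mopG L n) + pCons 0 s)"
      by (subst s(1)) (simp add: mop_Suc smult_add_right smult_diff_right)
    finally have "L (pCons 0 (mop L (Suc n) * q)) = coeff q n * mnorm L (Suc n)
       + L (mop L (Suc n) * (smult (coeff q n) (smult (malpha L n) (mop L n) + mopG L n) + pCons 0 s))"
      by (simp only: distrib_left L_add) (simp add: L_linear mnorm_def)
    also have "L (mop L (Suc n) * (smult (coeff q n) (smult (malpha L n) (mop L n) + mopG L n) + pCons 0 s)) = 0"
      using deg_lt_mop[of L n] deg_lt_mopG[of L n] s(2)
      by (intro orth deg_lt_add deg_lt_smult deg_lt_pCons) (auto intro: deg_lt_mono)
    finally show ?thesis using 1 by simp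
  qed
  then show ?case using orth by blast
qed

lemma mop_orth: "deg_lt q n \<Longrightarrow> L (mop L n * q) = 0"
  using mop_orth_G by blast

lemma L_mopG: "deg_lt q n \<Longrightarrow> L (mopG L n * q) = L (pCons 0 (mop L n * q))"
  using mop_orth_G by blast

lemma L_mop_deg: "deg_lt q (Suc n) \<Longrightarrow> L (mop L n * q) = coeff q n * mnorm L n"
proof -
  assume "deg_lt q (Suc n)"
  then obtain s where s: "q = smult (coeff q n) (mop L n) + s" "deg_lt s n"
    using split_off_mop by blast
  show ?thesis
    by (subst s(1)) (simp add: distrib_left L_linear mop_orth[OF s(2)] mnorm_def)
qed

text \<open>Testing \<open>p\<close> against itself would contradict positivity if \<open>p\<close>
  were nonzero.\<close>

lemma orth_eq_0:
  assumes "deg_lt p n" and "\<And>q. deg_lt q n \<Longrightarrow> L (p * q) = 0"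
  shows "p = 0"
  using L_pos[of p] assms by force

text \<open>The difference of two monic candidates has lower degree and is orthogonal to all lower
  degrees, hence to itself. This settles the \<open>THE\<close> in \<open>OP\<close>.\<close>

lemma mop_unique:
  assumes "degree p = n" "lead_coeff p = 1" "\<And>k. k < n \<Longrightarrow> L (p * monom 1 k) = 0"
  shows "p = mop L n"
proof -
  have dp: "deg_lt (p - mop L n) n"
    unfolding deg_lt_def
  proof (intro allI impI)
    fix i assume "n \<le> i"
    then show "coeff (p - mop L n) i = 0"
      using assms(1,2) by (cases "i = n") (auto simp: coeff_eq_0)
  qed
  \<comment> \<open>Induction on the degree: stripping the leading monomial extends orthogonality
    from monomials to all polynomials of lower degree.\<close>
  have orth: "L (p * q) = 0" if "deg_lt q n" for q
    using that
  proof (induction "Suc (degree q)" arbitrary: q rule: less_induct)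
    case less
    show ?case
    proof (cases "q = 0")
      case False
      have dq: "degree q < n"
        using less.prems False by (metis deg_lt_def leading_coeff_0_iff not_le)
      define s where "s = q - monom (lead_coeff q) (degree q)"
      have low: "deg_lt s (degree q)"
        unfolding deg_lt_def s_def
      proof (intro allI impI)
        fix i assume "degree q \<le> i"
        then show "coeff (q - monom (lead_coeff q) (degree q)) i = 0"
          by (cases "i = degree q") (auto simp: coeff_eq_0)
      qed
      have "L (p * s) = 0"
      proof (cases "s = 0")
        case False
        then have "degree s < degree q"
          using low by (metis deg_lt_def leading_coeff_0_iff not_le)
        then show ?thesis using less.hyps[of s] deg_lt_mono[OF low] dq by simp
      qed simp
      moreover have "q = s + smult (lead_coeff q) (monom 1 (degree q))"
        by (simp add: s_def smult_monom)
      ultimately show ?thesis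
        using assms(3)[OF dq] by (metis L_add L_smult add_0 distrib_left mult_smult_right mult_zero_right)
    qed simp
  qed
  have "p - mop L n = 0"
    by (rule orth_eq_0[OF dp]) (simp add: left_diff_distrib L_diff orth mop_orth)
  then show ?thesis by simp
qed

text \<open>Multiplying by \<open>mop L n\<close> and applying \<open>L\<close> isolates
  \<open>c\<close>, which makes the \<open>THE\<close> in \<open>alphan\<close> unique. At
  \<open>n = 0\<close> the truncated \<open>n - 1\<close> would merge the last two terms and leave
  \<open>c\<close> undetermined.\<close>

lemma three_term_coeff:
  assumes "pCons 0 (mop L n) = mop L (Suc n) + smult c (mop L n) + smult b (mop L (n - 1))"
    and "n \<ge> 1"
  shows "c = malpha L n"
proof -
  have lowP: "deg_lt (mop L (n - 1)) n" using deg_lt_mop[of L "n - 1"] assms(2) by simp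
  have "L (pCons 0 (mop L n) * mop L n) = c * mnorm L n"
    unfolding assms(1) using mop_orth[of "mop L n" "Suc n"] mop_orth[OF lowP] deg_lt_mop[of L n]
    by (simp add: distrib_right L_linear mnorm_def) (simp add: mult.commute)
  then show ?thesis using L_X_mop_mop[of n] mnorm_pos[of n] by simp
qed

lemma L_X_mop_prev: "L (pCons 0 (mop L (Suc n) * mop L n)) = mnorm L (Suc n)"
  using L_mopG[OF deg_lt_mop[of L n]] mnorm_pos[of n]
  by (simp add: mopG_Suc L_linear mbeta_Suc mnorm_def[symmetric])

end

section \<open>Functionals satisfying the Stein identity\<close>

text \<open>In the following quantities \<open>k\<close> stands for the jump of the weight at \<open>t\<close>.\<close>

definition auxR :: "(real poly \<Rightarrow> real) \<Rightarrow> real \<Rightarrow> real \<Rightarrow> nat \<Rightarrow> real" where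
  "auxR L k t n = k * (poly (mop L n) t)\<^sup>2 / mnorm L n"

definition auxr :: "(real poly \<Rightarrow> real) \<Rightarrow> real \<Rightarrow> real \<Rightarrow> nat \<Rightarrow> real" where
  "auxr L k t n = k * poly (mop L n) t * poly (mopG L n) t / mnorm L n"

definition auxX :: "(real poly \<Rightarrow> real) \<Rightarrow> real \<Rightarrow> real \<Rightarrow> nat \<Rightarrow> real" where
  "auxX L k t n = k * (poly (mopG L n) t)\<^sup>2 / mnorm L n"

locale stein_functional = pos_functional +
  fixes a t k :: real
  assumes stein: "L (pCons 0 (pderiv p) + smult (a + 1) p - pCons 0 p) = - (t * k * poly p t)"
begin

abbreviation "R \<equiv> auxR L k t"
abbreviation "r \<equiv> auxr L k t"
abbreviation "X \<equiv> auxX L k t"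
abbreviation "\<alpha> \<equiv> malpha L"
abbreviation "\<beta> \<equiv> mbeta L"

lemma poly_mop_Suc:
  "poly (mop L (Suc n)) t = (t - \<alpha> n) * poly (mop L n) t - poly (mopG L n) t"
  by (simp add: mop_Suc algebra_simps)

lemma poly_mopG_Suc: "poly (mopG L (Suc n)) t = \<beta> (Suc n) * poly (mop L n) t"
  by (simp add: mopG_Suc)

text \<open>This and the next two lemmas raise the index by evaluating the recurrence at
  \<open>t\<close>; \<open>\<beta> (Suc n)\<close>, a quotient of norms, absorbs the change of
  denominator.\<close>

lemma X_Suc: "X (Suc n) = \<beta> (Suc n) * R n"
  using mnorm_pos[of n] mnorm_pos[of "Suc n"]
  by (simp add: auxX_def auxR_def poly_mopG_Suc mbeta_Suc field_simps power2_eq_square)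

lemma r_Suc: "r (Suc n) = (t - \<alpha> n) * R n - r n"
  using mnorm_pos[of n] mnorm_pos[of "Suc n"]
  by (simp add: auxr_def auxR_def poly_mopG_Suc poly_mop_Suc mbeta_Suc field_simps power2_eq_square)

lemma beta_R_Suc: "\<beta> (Suc n) * R (Suc n) = (t - \<alpha> n)\<^sup>2 * R n - 2 * (t - \<alpha> n) * r n + X n"
  using mnorm_pos[of n] mnorm_pos[of "Suc n"]
  by (simp add: auxr_def auxR_def auxX_def poly_mop_Suc mbeta_Suc field_simps power2_eq_square)

lemma X_R: "X n * R n = (r n)\<^sup>2"
  by (simp add: auxr_def auxR_def auxX_def field_simps power2_eq_square)

text \<open>The Stein identity for the product: the terms with \<open>q\<close> and with
  \<open>x q'\<close> vanish by orthogonality, as \<open>x q'\<close> has no larger degree than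
  \<open>q\<close>.\<close>

lemma stein_mop_mult:
  assumes "deg_lt q n"
  shows "L (pCons 0 (pderiv (mop L n)) * q) = L (pCons 0 (mop L n * q)) - t * k * poly (mop L n) t * poly q t"
proof -
  have "L (pCons 0 (pderiv (mop L n * q))) + (a + 1) * L (mop L n * q) - L (pCons 0 (mop L n * q))
      = - (t * k * poly (mop L n) t * poly q t)"
    using stein[of "mop L n * q"] by (simp add: L_linear mult.assoc)
  moreover have "L (mop L n * q) = 0" by (rule mop_orth[OF assms])
  moreover have "pCons 0 (pderiv (mop L n * q)) = pCons 0 (pderiv (mop L n) * q) + pCons 0 (mop L n * pderiv q)"
    by (simp add: pderiv_mult algebra_simps)
  moreover have "L (mop L n * pCons 0 (pderiv q)) = 0"
    by (rule mop_orth[OF deg_lt_X_pderiv[OF assms]])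
  ultimately have "L (pCons 0 (pderiv (mop L n) * q)) =
      L (pCons 0 (mop L n * q)) - t * k * poly (mop L n) t * poly q t"
    by (simp only: L_add) simp
  then show ?thesis by simp
qed

text \<open>The Stein identity for the square of \<open>mop L n\<close>, where \<open>x P'\<close>
  pairs with \<open>P\<close> to \<open>n\<close> times the norm because its leading coefficient is
  \<open>n\<close>.\<close>

lemma alpha_eq: "\<alpha> n = 2 * real n + 1 + a + t * R n"
proof -
  let ?P = "mop L n"
  have "L (pCons 0 (pderiv (?P * ?P))) + (a + 1) * L (?P * ?P) - L (pCons 0 (?P * ?P))
      = - (t * k * (poly ?P t)\<^sup>2)"
    using stein[of "?P * ?P"] by (simp add: L_linear power2_eq_square)
  moreover have "L (pCons 0 (pderiv (?P * ?P))) = 2 * L (?P * pCons 0 (pderiv ?P))"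
    using L_add[of "pCons 0 (?P * pderiv ?P)" "pCons 0 (?P * pderiv ?P)"] by (simp add: pderiv_mult)
  moreover have "L (?P * pCons 0 (pderiv ?P)) = real n * mnorm L n"
    using L_mop_deg[OF deg_lt_X_pderiv[OF deg_lt_mop]] by (simp add: coeff_X_pderiv del: mult_pCons_right)
  ultimately have "2 * (real n * mnorm L n) + (a + 1) * mnorm L n - \<alpha> n * mnorm L n = - (t * k * (poly ?P t)\<^sup>2)"
    by (simp add: L_smult L_X_mop_mop mnorm_def del: mult_pCons_right)
  then show ?thesis
    using mnorm_pos[of n] by (simp add: auxR_def field_simps)
qed

text \<open>In \<open>x P' - (n + 1) P\<close> the top terms cancel and the next coefficient is
  multiplied by -1. Pairing with \<open>mop L n\<close> reads it off, and
  \<open>stein_mop_mult\<close> evaluates the same pairing.\<close>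

lemma coeff_mop_subleading: "coeff (mop L (Suc n)) n = t * r (Suc n) - \<beta> (Suc n)"
proof -
  let ?P = "mop L (Suc n)"
  let ?q = "pCons 0 (pderiv ?P) - smult (real (Suc n)) ?P"
  have q: "deg_lt ?q (Suc n)"
    unfolding deg_lt_def
  proof (intro allI impI)
    fix i assume "Suc n \<le> i"
    then show "coeff ?q i = 0"
      using deg_lt_mop[of L "Suc n"] 
      by (cases "i = Suc n") (auto simp: coeff_X_pderiv deg_lt_def simp del: coeff_pCons_Suc)
  qed
  have "L (mop L n * ?q) = coeff ?q n * mnorm L n" by (rule L_mop_deg[OF q])
  also have "coeff ?q n = - coeff ?P n"
    by (simp add: coeff_X_pderiv algebra_simps del: coeff_pCons_Suc)
  finally have "L (mop L n * ?q) = - coeff ?P n * mnorm L n" .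
  moreover have "L (mop L n * ?q) = L (pCons 0 (pderiv ?P) * mop L n) - real (Suc n) * L (?P * mop L n)"
    by (simp add: right_diff_distrib L_linear mult.commute)
  moreover have "L (?P * mop L n) = 0" by (rule mop_orth[OF deg_lt_mop])
  ultimately have "- coeff ?P n * mnorm L n = mnorm L (Suc n) - t * k * poly ?P t * poly (mop L n) t"
    using stein_mop_mult[OF deg_lt_mop[of L n]] by (simp add: L_X_mop_prev)
  then show ?thesis
    using mnorm_pos[of n] mnorm_pos[of "Suc n"]
    by (simp add: auxr_def mbeta_Suc poly_mopG_Suc field_simps)
qed

lemma r_0: "r 0 = 0" and X_0: "X 0 = 0"
  by (simp_all add: auxr_def auxX_def)

text \<open>By the recurrence \<open>\<alpha> n\<close> is the difference of two consecutive
  subleading coefficients.\<close>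

lemma alpha_diff: "\<alpha> n = \<beta> (Suc n) - \<beta> n - t * (r (Suc n) - r n)"
proof (cases n)
  case 0
  have "coeff (mop L (Suc 0)) 0 = - \<alpha> 0" by (simp add: mop_Suc)
  then show ?thesis using coeff_mop_subleading[of 0] 0 by (simp add: r_0)
next
  case (Suc m)
  have "coeff (mop L (Suc n)) n = coeff (mop L n) m - \<alpha> n"
    using deg_lt_mopG[of L n] Suc coeff_mop_top[of L n] by (simp add: mop_Suc deg_lt_def del: coeff_mop_top)
  then show ?thesis using coeff_mop_subleading[of n] coeff_mop_subleading[of m] Suc
    by (simp add: algebra_simps)
qed

text \<open>In the induction step \<open>X_Suc\<close> and \<open>beta_R_Suc\<close> turn both
  products with \<open>\<beta> (Suc n)\<close> into data at \<open>n\<close>;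
  \<open>alpha_diff\<close>, \<open>alpha_eq\<close> and the hypothesis for \<open>X n\<close> leave
  a polynomial identity.\<close>

lemma first_integral: "real n * (real n + a) + (2 * real n + a) * r n + X n = \<beta> n * (1 - R n)"
proof (induction n)
  case 0
  show ?case by (simp add: r_0 X_0)
next
  case (Suc n)
  define N where "N = real n"
  have X: "X n = \<beta> n * (1 - R n) - N * (N + a) - (2 * N + a) * r n"
    using Suc.IH by (simp add: N_def)
  have b: "\<beta> (Suc n) = \<alpha> n + \<beta> n + t * (r (Suc n) - r n)"
    using alpha_diff[of n] by simp
  have al: "\<alpha> n = 2 * N + 1 + a + t * R n"
    using alpha_eq[of n] by (simp add: N_def)
  have "(N + 1) * (N + 1 + a) + (2 * N + 2 + a) * r (Suc n) + \<beta> (Suc n) * R (Suc n)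
      = \<beta> (Suc n) * (1 - R n)"
    unfolding beta_R_Suc unfolding b r_Suc X al by (simp add: algebra_simps power2_eq_square)
  then show ?case by (simp add: N_def X_Suc algebra_simps)
qed

end

section \<open>The Laguerre weight with a jump\<close>

text \<open>Both pieces of the weight are such tails: \<open>s = 0\<close> gives the Laguerre
  functional, \<open>s = t\<close> the part beyond the jump.\<close>

definition tail_moment :: "real \<Rightarrow> real \<Rightarrow> real poly \<Rightarrow> real" where
  "tail_moment a s p = (LBINT x:{s<..}. poly p x * (x powr a * exp (- x)))"

text \<open>The integrand is that of Euler's integral for Gamma at \<open>a + i + 1\<close>.\<close>

lemma gamma_monom_integrable:
  assumes "a > 0"
  shows "set_integrable lborel {0<..} (\<lambda>x::real. x ^ i * (x powr a * exp (- x)))"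
proof -
  define b where "b = a + real i + 1"
  have b: "b > 0" using assms by (simp add: b_def)
  have "integrable lborel (\<lambda>t::real. indicator {0..} t * t powr (b - 1) / exp t)"
    by (rule integrableI_nn_integral_finite[where x = "Gamma b"])
       (use Gamma_conv_nn_integral_real[OF b] in auto)
  moreover have "indicator {0..} x * x powr (b - 1) / exp x
      = indicator {0<..} x *\<^sub>R (x ^ i * (x powr a * exp (- x)))" for x :: real
  proof (cases "x > 0")
    case True
    have "x powr (b - 1) = x powr a * x powr real i" by (simp add: b_def powr_add)
    then show ?thesis using True by (simp add: powr_realpow exp_minus field_simps)
  next
    case False
    \<comment> \<open>The indicators differ at \<open>x = 0\<close>, where
      \<open>0 powr (b - 1)\<close> is 0.\<close>
    then show ?thesis by (cases "x = 0") (auto simp: indicator_def)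
  qed
  ultimately show ?thesis by (simp add: set_integrable_def)
qed

lemma tail_integrable:
  fixes p :: "real poly"
  assumes "a > 0" "s \<ge> 0"
  shows "set_integrable lborel {s<..} (\<lambda>x. poly p x * (x powr a * exp (- x)))"
proof -
  have "set_integrable lborel {0<..} (\<lambda>x. \<Sum>i\<le>degree p. coeff p i * (x ^ i * (x powr a * exp (- x))))"
    unfolding set_integrable_def scaleR_sum_right
    by (intro Bochner_Integration.integrable_sum)
       (use set_integrable_mult_right[OF gamma_monom_integrable[OF assms(1)]] in \<open>simp add: set_integrable_def\<close>)
  then have "set_integrable lborel {0<..} (\<lambda>x. poly p x * (x powr a * exp (- x)))"
    by (simp add: poly_altdef sum_distrib_right mult.assoc)
  then show ?thesis by (rule set_integrable_subset) (use assms(2) in auto)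
qed

lemma tail_moment_add:
  assumes "a > 0" "s \<ge> 0"
  shows "tail_moment a s (p + q) = tail_moment a s p + tail_moment a s q"
  using set_integral_add(2)[OF tail_integrable[OF assms, of p] tail_integrable[OF assms, of q]]
  by (simp add: tail_moment_def distrib_right)

lemma tail_moment_smult: "tail_moment a s (smult c p) = c * tail_moment a s p"
  by (simp add: tail_moment_def mult.assoc)

lemma tail_moment_nonneg: "tail_moment a s (p * p) \<ge> 0"
  unfolding tail_moment_def set_lebesgue_integral_def
  by (intro integral_nonneg_AE) auto

text \<open>A vanishing integral would force the nonnegative integrand to vanish almost everywhere;
  off the finitely many roots it is positive on the tail, so an interval of length 1 would be
  null.\<close>

lemma tail_moment_pos:
  assumes "a > 0" "s \<ge> 0" "p \<noteq> 0"
  shows "tail_moment a s (p * p) > 0"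
proof (rule ccontr)
  let ?f = "\<lambda>x. indicator {s<..} x *\<^sub>R (poly (p * p) x * (x powr a * exp (- x)))"
  assume "\<not> ?thesis"
  then have "integral\<^sup>L lborel ?f = 0"
    using tail_moment_nonneg[of a s p] unfolding tail_moment_def set_lebesgue_integral_def by linarith
  moreover have "integrable lborel ?f"
    using tail_integrable[OF assms(1,2), of "p * p"] by (simp add: set_integrable_def)
  ultimately have "AE x in lborel. ?f x = 0"
    by (subst (asm) integral_nonneg_eq_0_iff_AE) auto
  moreover have "AE x in lborel. x \<notin> {x. poly p x = 0}"
    by (rule AE_not_in) (simp add: finite_imp_null_set_lborel poly_roots_finite assms(3))
  ultimately have "AE x in lborel. x \<notin> {s<..<s + 1}"
    by eventually_elim (use assms(2) in \<open>auto simp: indicator_def split: if_splits\<close>)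
  then have "{s<..<s + 1} \<in> null_sets lborel"
    by (subst AE_iff_null_sets) auto
  then show False by (auto simp: null_sets_def)
qed

lemma poly_div_exp_tendsto_0: "((\<lambda>x. poly q x / exp x) \<longlongrightarrow> 0) at_top" for q :: "real poly"
proof -
  have "((\<lambda>x. \<Sum>i\<le>degree q. coeff q i * (x ^ i / exp x)) \<longlongrightarrow> (\<Sum>i\<le>degree q. coeff q i * 0)) at_top"
    by (intro tendsto_sum tendsto_mult tendsto_const tendsto_power_div_exp_0)
  then show ?thesis by (simp add: poly_altdef sum_divide_distrib)
qed

lemma poly_powr_exp_tendsto_0:
  "((\<lambda>x. poly p x * (x powr b * exp (- x))) \<longlongrightarrow> 0) at_top" for b :: real
proof -
  obtain m :: nat where m: "b \<le> real m" using real_arch_simple by blast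
  show ?thesis
  proof (rule Lim_null_comparison)
    show "((\<lambda>x. \<bar>poly (p * monom 1 m) x / exp x\<bar>) \<longlongrightarrow> 0) at_top"
      using tendsto_rabs_zero[OF poly_div_exp_tendsto_0] .
    show "\<forall>\<^sub>F x in at_top. norm (poly p x * (x powr b * exp (- x))) \<le> \<bar>poly (p * monom 1 m) x / exp x\<bar>"
      using eventually_ge_at_top[of 1]
    proof eventually_elim
      case (elim x)
      have "x powr b \<le> x powr real m" using elim m by (intro powr_mono) auto
      then have "x powr b \<le> x ^ m" using elim by (simp add: powr_realpow)
      then have "\<bar>poly p x\<bar> * (x powr b * exp (- x)) \<le> \<bar>poly p x\<bar> * (x ^ m * exp (- x))"
        by (intro mult_left_mono mult_right_mono) auto
      then show ?case using elim
        by (simp add: abs_mult poly_monom exp_minus divide_inverse)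
    qed
  qed
qed

text \<open>Integration by parts with primitive \<open>p x^(a + 1) e^(-x)\<close>: the extra factor
  x keeps the derivative a polynomial times the weight, and only the boundary at \<open>s\<close>
  contributes.\<close>

lemma tail_moment_stein:
  assumes "a > 0" "s \<ge> 0"
  shows "tail_moment a s (pCons 0 (pderiv p) + smult (a + 1) p - pCons 0 p)
    = - (s * (s powr a * exp (- s)) * poly p s)"
proof -
  let ?q = "pCons 0 (pderiv p) + smult (a + 1) p - pCons 0 p"
  define F where "F x = poly p x * (x powr (a + 1) * exp (- x))" for x
  have cont: "continuous_on {0..} F"
    unfolding F_def using assms(1) by (intro continuous_intros continuous_on_powr') auto
  have "(LBINT x=ereal s..\<infinity>. poly ?q x * (x powr a * exp (- x))) = 0 - F s"
  proof (rule interval_integral_FTC_integrable)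
    show "(F has_vector_derivative poly ?q x * (x powr a * exp (- x))) (at x)"
      if "ereal s < ereal x" for x
    proof -
      have x: "x > 0" using that assms(2) by simp
      have "(F has_real_derivative poly (pderiv p) x * (x powr (a + 1) * exp (- x))
          + poly p x * ((a + 1) * x powr a * exp (- x) - x powr (a + 1) * exp (- x))) (at x)"
        unfolding F_def using x
        by (auto intro!: derivative_eq_intros simp: powr_diff algebra_simps)
      moreover have "x powr (a + 1) = x * x powr a" using x by (simp add: powr_add)
      ultimately show ?thesis
        by (simp add: has_real_derivative_iff_has_vector_derivative[symmetric] algebra_simps)
    qed
    show "isCont (\<lambda>x. poly ?q x * (x powr a * exp (- x))) x" if "ereal s < ereal x" for x
      using that assms(2) by (intro continuous_intros) auto
    show "set_integrable lborel (einterval (ereal s) \<infinity>) (\<lambda>x. poly ?q x * (x powr a * exp (- x)))"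
      using tail_integrable[OF assms, of ?q] by simp
    \<comment> \<open>Continuity on the closed half-line is used because \<open>s\<close> may be
      0.\<close>
    have "(F \<longlongrightarrow> F s) (at s within {0..})"
      using cont assms(2) by (auto simp: continuous_on_def)
    then have "(F \<longlongrightarrow> F s) (at_right s)"
      by (rule tendsto_within_subset) (use assms(2) in auto)
    then show "((F \<circ> real_of_ereal) \<longlongrightarrow> F s) (at_right (ereal s))"
      by (simp add: ereal_tendsto_simps)
    show "((F \<circ> real_of_ereal) \<longlongrightarrow> 0) (at_left \<infinity>)"
      unfolding ereal_tendsto_simps F_def by (rule poly_powr_exp_tendsto_0)
  qed simp
  moreover have "F s = s * (s powr a * exp (- s)) * poly p s"
    using assms(2) by (cases "s = 0") (simp_all add: F_def powr_add)
  ultimately show ?thesis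
    unfolding tail_moment_def interval_lebesgue_integral_def by simp
qed

text \<open>Near \<open>t\<close> the tail is the full moment minus an integral from 0 to
  \<open>s\<close>, to which the fundamental theorem applies.\<close>

lemma tail_moment_has_derivative:
  assumes "a > 0" "t > 0"
  shows "((\<lambda>s. tail_moment a s p) has_real_derivative - (poly p t * (t powr a * exp (- t)))) (at t)"
proof -
  define f where "f x = poly p x * (x powr a * exp (- x))" for x
  have cont: "continuous_on {0..t + 1} f"
    unfolding f_def using assms(1) by (intro continuous_intros continuous_on_powr') auto
  have split: "tail_moment a s p = tail_moment a 0 p - integral {0..s} f" if s: "s > 0" for s
  proof -
    have i0: "set_integrable lborel {0<..s} f"
      using tail_integrable[OF assms(1), of 0 p] unfolding f_def
      by (rule set_integrable_subset) auto
    have i1: "set_integrable lborel {s<..} f"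
      using tail_integrable[OF assms(1), of s p] s by (simp add: f_def[abs_def])
    have "{0<..s} \<union> {s<..} = {0<..}" using s by auto
    moreover have "(LBINT x:{0<..s} \<union> {s<..}. f x) = (LBINT x:{0<..s}. f x) + (LBINT x:{s<..}. f x)"
      by (rule set_integral_Un[OF _ i0 i1]) auto
    ultimately have "tail_moment a 0 p = (LBINT x:{0<..s}. f x) + tail_moment a s p"
      by (simp add: tail_moment_def f_def)
    moreover have "(LBINT x:{0<..s}. f x) = integral {0<..s} f"
      by (rule set_borel_integral_eq_integral(2)[OF i0])
    moreover have "integral {0<..s} f = integral {0..s} f"
      by (rule integral_subset_negligible) (auto intro: negligible_subset[of "{0}"])
    ultimately show ?thesis by simp
  qed
  \<comment> \<open>Extending the interval past \<open>t\<close> makes \<open>t\<close> interior and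
    the derivative two-sided.\<close>
  have "((\<lambda>s. integral {0..s} f) has_real_derivative f t) (at t within {0..t + 1})"
    by (rule integral_has_real_derivative[OF cont]) (use assms in auto)
  moreover have "at t within {0..t + 1} = at t"
    by (rule at_within_Icc_at) (use assms in auto)
  ultimately have "((\<lambda>s. tail_moment a 0 p - integral {0..s} f) has_real_derivative - f t) (at t)"
    by (auto intro!: derivative_eq_intros)
  moreover have "\<forall>\<^sub>F s in nhds t. tail_moment a s p = tail_moment a 0 p - integral {0..s} f"
    using eventually_nhds_in_open[of "{0<..}" t] assms(2) by (auto elim!: eventually_mono intro: split)
  ultimately show ?thesis
    unfolding f_def by (subst DERIV_cong_ev[OF refl _ refl]) auto
qed

section \<open>The functional of the weight with a jump\<close>

definition jump_functional :: "real \<Rightarrow> real \<Rightarrow> real \<Rightarrow> real \<Rightarrow> real poly \<Rightarrow> real" where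
  "jump_functional a A B t p = A * tail_moment a 0 p + B * tail_moment a t p"

definition jump :: "real \<Rightarrow> real \<Rightarrow> real \<Rightarrow> real" where
  "jump a B t = B * t powr a * exp (- t)"

text \<open>The integrands agree pointwise, even at \<open>x = 0\<close>, where
  \<open>0 powr a = 0\<close> hides the difference between \<open>{0..}\<close> and
  \<open>{0<..}\<close>.\<close>

lemma ip_eq_jump_functional:
  assumes "a > 0" "t > 0"
  shows "ip a A B t p q = jump_functional a A B t (p * q)"
proof -
  let ?f = "\<lambda>x. poly (p * q) x * (x powr a * exp (- x))"
  have "ip a A B t p q = (LBINT x. A * (indicator {0<..} x *\<^sub>R ?f x) + B * (indicator {t<..} x *\<^sub>R ?f x))"
    unfolding ip_def set_lebesgue_integral_def
  proof (rule Bochner_Integration.integral_cong[OF refl])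
    fix x :: real
    show "indicator {0..} x *\<^sub>R (poly p x * poly q x * weight a A B t x)
        = A * (indicator {0<..} x *\<^sub>R ?f x) + B * (indicator {t<..} x *\<^sub>R ?f x)"
      using assms(2) by (cases "x = 0") (auto simp: weight_def indicator_def algebra_simps)
  qed
  also have "\<dots> = (LBINT x. A * (indicator {0<..} x *\<^sub>R ?f x)) + (LBINT x. B * (indicator {t<..} x *\<^sub>R ?f x))"
    by (intro Bochner_Integration.integral_add integrable_mult_right)
       (use tail_integrable[OF assms(1), of 0 "p * q"] tail_integrable[OF assms(1), of t "p * q"] assms(2)
        in \<open>simp_all add: set_integrable_def\<close>)
  also have "\<dots> = jump_functional a A B t (p * q)"
    unfolding jump_functional_def tail_moment_def set_lebesgue_integral_def
    by (simp only: integral_mult_right_zero)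
  finally show ?thesis .
qed

text \<open>The boundary term of the first tail vanishes at 0, so only the jump at \<open>t\<close>
  remains; strict positivity comes from the second tail.\<close>

lemma stein_functional_jump_functional:
  assumes "a > 0" "A \<ge> 0" "B > 0" "t > 0"
  shows "stein_functional (jump_functional a A B t) a t (jump a B t)"
proof
  note [simp] = tail_moment_add tail_moment_smult
  show "jump_functional a A B t (p + q) = jump_functional a A B t p + jump_functional a A B t q" for p q
    using assms by (simp add: jump_functional_def algebra_simps)
  show "jump_functional a A B t (smult c p) = c * jump_functional a A B t p" for c p
    by (simp add: jump_functional_def algebra_simps)
  show "jump_functional a A B t (p * p) > 0" if "p \<noteq> 0" for p
    using assms that tail_moment_nonneg[of a 0 p] tail_moment_pos[of a t p]
    by (simp add: jump_functional_def add_nonneg_pos)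
  show "jump_functional a A B t (pCons 0 (pderiv p) + smult (a + 1) p - pCons 0 p)
      = - (t * jump a B t * poly p t)" for p
    using assms tail_moment_stein[of a t p] tail_moment_stein[of a 0 p]
    by (simp add: jump_functional_def jump_def)
qed

lemma jump_functional_has_derivative:
  assumes "a > 0" "t > 0"
  shows "((\<lambda>s. jump_functional a A B s p) has_real_derivative - (jump a B t * poly p t)) (at t)"
  unfolding jump_functional_def
  by (auto intro!: derivative_eq_intros tail_moment_has_derivative[OF assms] simp: jump_def)

section \<open>Dependence on the position of the jump\<close>

text \<open>Coefficientwise differentiation; the uniform degree bound turns evaluations and
  functionals into sums over a fixed finite range.\<close>

definition has_poly_deriv :: "(real \<Rightarrow> real poly) \<Rightarrow> real poly \<Rightarrow> real \<Rightarrow> bool" where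
  "has_poly_deriv P Q t \<longleftrightarrow> (\<exists>N. \<forall>s. degree (P s) \<le> N) \<and>
     (\<forall>i. ((\<lambda>s. coeff (P s) i) has_real_derivative coeff Q i) (at t))"

lemma has_poly_derivI:
  assumes "\<And>s. degree (P s) \<le> N"
    and "\<And>i. ((\<lambda>s. coeff (P s) i) has_real_derivative coeff Q i) (at t)"
  shows "has_poly_deriv P Q t"
  using assms unfolding has_poly_deriv_def by blast

lemma has_poly_derivE:
  assumes "has_poly_deriv P Q t"
  obtains N where "\<And>s. degree (P s) \<le> N" "degree Q \<le> N"
    "\<And>i. ((\<lambda>s. coeff (P s) i) has_real_derivative coeff Q i) (at t)"
proof -
  obtain N where N: "\<And>s. degree (P s) \<le> N"
    and D: "\<And>i. ((\<lambda>s. coeff (P s) i) has_real_derivative coeff Q i) (at t)"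
    using assms unfolding has_poly_deriv_def by blast
  have "degree Q \<le> N"
  proof (rule degree_le, intro allI impI)
    fix i assume "N < i"
    then have "coeff (P s) i = 0" for s using N[of s] by (intro coeff_eq_0) simp
    then have "((\<lambda>s. 0) has_real_derivative coeff Q i) (at t)" using D[of i] by simp
    then show "coeff Q i = 0" using DERIV_unique[OF _ DERIV_const] by blast
  qed
  then show thesis using that N D by blast
qed

lemma has_poly_deriv_const: "has_poly_deriv (\<lambda>_. p) 0 t"
  by (rule has_poly_derivI) auto

lemma has_poly_deriv_diff:
  assumes "has_poly_deriv P Q t" "has_poly_deriv U V t"
  shows "has_poly_deriv (\<lambda>s. P s - U s) (Q - V) t"
proof -
  obtain N where N: "\<And>s. degree (P s) \<le> N"
    and D: "\<And>i. ((\<lambda>s. coeff (P s) i) has_real_derivative coeff Q i) (at t)"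
    using assms(1) by (elim has_poly_derivE) blast
  obtain M where M: "\<And>s. degree (U s) \<le> M"
    and E: "\<And>i. ((\<lambda>s. coeff (U s) i) has_real_derivative coeff V i) (at t)"
    using assms(2) by (elim has_poly_derivE) blast
  show ?thesis
  proof (rule has_poly_derivI)
    show "degree (P s - U s) \<le> max N M" for s
      using N[of s] M[of s] by (intro degree_diff_le) auto
    show "((\<lambda>s. coeff (P s - U s) i) has_real_derivative coeff (Q - V) i) (at t)" for i
      using DERIV_diff[OF D E] by simp
  qed
qed

lemma has_poly_deriv_mult:
  assumes "has_poly_deriv P Q t" "has_poly_deriv U V t"
  shows "has_poly_deriv (\<lambda>s. P s * U s) (Q * U t + P t * V) t"
proof -
  obtain N where N: "\<And>s. degree (P s) \<le> N"
    and D: "\<And>i. ((\<lambda>s. coeff (P s) i) has_real_derivative coeff Q i) (at t)"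
    using assms(1) by (elim has_poly_derivE) blast
  obtain M where M: "\<And>s. degree (U s) \<le> M"
    and E: "\<And>i. ((\<lambda>s. coeff (U s) i) has_real_derivative coeff V i) (at t)"
    using assms(2) by (elim has_poly_derivE) blast
  show ?thesis
  proof (rule has_poly_derivI)
    show "degree (P s * U s) \<le> N + M" for s
      using degree_mult_le[of "P s" "U s"] N[of s] M[of s] by simp
    show "((\<lambda>s. coeff (P s * U s) i) has_real_derivative coeff (Q * U t + P t * V) i) (at t)" for i
      unfolding coeff_mult coeff_add sum.distrib[symmetric]
      by (auto intro!: derivative_eq_intros D E simp: algebra_simps)
  qed
qed

lemma has_poly_deriv_pCons:
  assumes "has_poly_deriv P Q t"
  shows "has_poly_deriv (\<lambda>s. pCons 0 (P s)) (pCons 0 Q) t"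
  using has_poly_deriv_mult[OF has_poly_deriv_const[of "[:0, 1:]"] assms] by simp

lemma has_poly_deriv_smult:
  assumes "(c has_real_derivative c') (at t)" "has_poly_deriv P Q t"
  shows "has_poly_deriv (\<lambda>s. smult (c s) (P s)) (smult c' (P t) + smult (c t) Q) t"
proof -
  have "has_poly_deriv (\<lambda>s. [:c s:]) [:c':] t"
    by (rule has_poly_derivI[of _ 0]) (auto simp: coeff_pCons assms(1) split: nat.split)
  from has_poly_deriv_mult[OF this assms(2)] show ?thesis by simp
qed

lemma poly_sum_upto:
  fixes p :: "'a::comm_semiring_1 poly"
  assumes "degree p \<le> N"
  shows "poly p x = (\<Sum>i\<le>N. coeff p i * x ^ i)"
  by (subst poly_as_sum_of_monoms'[OF assms, symmetric]) (simp add: poly_sum poly_monom)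

text \<open>The chain rule along the diagonal: one term from the argument, one from the
  coefficients.\<close>

lemma poly_diagonal_has_derivative:
  assumes "has_poly_deriv P Q t"
  shows "((\<lambda>s. poly (P s) s) has_real_derivative poly (pderiv (P t)) t + poly Q t) (at t)"
proof -
  obtain N where N: "\<And>s. degree (P s) \<le> N" "degree Q \<le> N"
    and D: "\<And>i. ((\<lambda>s. coeff (P s) i) has_real_derivative coeff Q i) (at t)"
    using assms by (elim has_poly_derivE) blast
  have 1: "((\<lambda>s. \<Sum>i\<le>N. coeff (P s) i * s ^ i) has_real_derivative
      (\<Sum>i\<le>N. coeff Q i * t ^ i + coeff (P t) i * (real i * t ^ (i - Suc 0)))) (at t)"
    by (auto intro!: derivative_eq_intros D simp: algebra_simps)
  have "((\<lambda>s. \<Sum>i\<le>N. coeff (P t) i * s ^ i) has_real_derivative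
      (\<Sum>i\<le>N. coeff (P t) i * (real i * t ^ (i - Suc 0)))) (at t)"
    by (auto intro!: derivative_eq_intros simp: algebra_simps)
  then have "poly (pderiv (P t)) t = (\<Sum>i\<le>N. coeff (P t) i * (real i * t ^ (i - Suc 0)))"
    using poly_DERIV[of "P t" t] DERIV_unique unfolding poly_sum_upto[OF N(1)[of t]] by blast
  then show ?thesis
    using 1 unfolding poly_sum_upto[OF N(1)] poly_sum_upto[OF N(2)] by (simp add: sum.distrib add.commute)
qed

section \<open>One-parameter families of functionals\<close>

lemma (in pos_functional) L_sum: "L (sum f A) = (\<Sum>i\<in>A. L (f i))"
  by (induction A rule: infinite_finite_induct) (simp_all add: L_add)

lemma (in pos_functional) L_sum_upto:
  assumes "degree p \<le> N"
  shows "L p = (\<Sum>i\<le>N. coeff p i * L (monom 1 i))"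
  using poly_as_sum_of_monoms'[OF assms] L_sum[of "\<lambda>i. monom (coeff p i) i" "{..N}"]
  by (simp flip: L_smult add: smult_monom)

text \<open>The last assumption is the logarithmic derivative \<open>a / t - 1\<close> of
  \<open>t\<^sup>a e\<^sup>-\<^sup>t\<close>.\<close>

locale stein_family =
  fixes F :: "real \<Rightarrow> real poly \<Rightarrow> real" and a :: real and \<kappa> :: "real \<Rightarrow> real"
  assumes stein_functional: "t > 0 \<Longrightarrow> stein_functional (F t) a t (\<kappa> t)"
    and F_deriv: "t > 0 \<Longrightarrow> ((\<lambda>s. F s p) has_real_derivative - (\<kappa> t * poly p t)) (at t)"
    and kappa_deriv: "t > 0 \<Longrightarrow> (\<kappa> has_real_derivative \<kappa> t * (a / t - 1)) (at t)"
begin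

lemma eventually_pos: "t > 0 \<Longrightarrow> \<forall>\<^sub>F s in nhds t. s > 0" for t :: real
  using eventually_nhds_in_open[of "{0<..}" t] by simp

lemma pos_functional: "t > 0 \<Longrightarrow> pos_functional (F t)"
  using stein_functional by (simp add: stein_functional_def)

text \<open>The product rule on the monomial expansion: moving the polynomial gives the first term,
  moving the functional the boundary term.\<close>

lemma F_diagonal_deriv:
  assumes "t > 0" "has_poly_deriv P Q t"
  shows "((\<lambda>s. F s (P s)) has_real_derivative F t Q - \<kappa> t * poly (P t) t) (at t)"
proof -
  obtain N where N: "\<And>s. degree (P s) \<le> N" "degree Q \<le> N"
    and D: "\<And>i. ((\<lambda>s. coeff (P s) i) has_real_derivative coeff Q i) (at t)"
    using assms(2) by (elim has_poly_derivE) blast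
  have "((\<lambda>s. \<Sum>i\<le>N. coeff (P s) i * F s (monom 1 i)) has_real_derivative
      (\<Sum>i\<le>N. coeff Q i * F t (monom 1 i) + coeff (P t) i * - (\<kappa> t * t ^ i))) (at t)"
    using assms(1)
    by (auto intro!: derivative_eq_intros D F_deriv simp: algebra_simps poly_monom)
  also have "(\<Sum>i\<le>N. coeff Q i * F t (monom 1 i) + coeff (P t) i * - (\<kappa> t * t ^ i))
      = F t Q - \<kappa> t * poly (P t) t"
    unfolding pos_functional.L_sum_upto[OF pos_functional[OF assms(1)] N(2)] poly_sum_upto[OF N(1)]
    by (simp add: sum_subtractf sum_distrib_left algebra_simps)
  finally have "((\<lambda>s. \<Sum>i\<le>N. coeff (P s) i * F s (monom 1 i)) has_real_derivative
      F t Q - \<kappa> t * poly (P t) t) (at t)" .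
  moreover have "\<forall>\<^sub>F s in nhds t. F s (P s) = (\<Sum>i\<le>N. coeff (P s) i * F s (monom 1 i))"
    using eventually_pos[OF assms(1)]
    by eventually_elim (rule pos_functional.L_sum_upto[OF pos_functional N(1)])
  ultimately show ?thesis by (subst DERIV_cong_ev[OF refl _ refl])
qed

text \<open>Existence only: the recursion uses rational operations with nonzero norms as
  denominators. The values of the derivatives are found afterwards.\<close>

lemma mop_differentiable:
  assumes t: "t > 0"
  shows "(\<exists>Q. has_poly_deriv (\<lambda>s. mop (F s) n) Q t) \<and> (\<exists>V. has_poly_deriv (\<lambda>s. mopG (F s) n) V t)"
proof (induction n)
  case 0
  show ?case using has_poly_deriv_const by auto
next
  case (Suc n)
  interpret stein_functional "F t" a t "\<kappa> t" by (rule stein_functional[OF t])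
  obtain Q V where Q: "has_poly_deriv (\<lambda>s. mop (F s) n) Q t" and V: "has_poly_deriv (\<lambda>s. mopG (F s) n) V t"
    using Suc by blast
  have nz: "mnorm (F t) n \<noteq> 0" using mnorm_pos[of n] by simp
  obtain h' where h': "((\<lambda>s. mnorm (F s) n) has_real_derivative h') (at t)"
    unfolding mnorm_def using F_diagonal_deriv[OF t has_poly_deriv_mult[OF Q Q]] by blast
  obtain \<alpha>' where "((\<lambda>s. malpha (F s) n) has_real_derivative \<alpha>') (at t)"
    unfolding malpha_def
    using DERIV_divide[OF F_diagonal_deriv[OF t has_poly_deriv_pCons[OF has_poly_deriv_mult[OF Q Q]]] h' nz]
    by blast
  then obtain Q' where Q': "has_poly_deriv (\<lambda>s. mop (F s) (Suc n)) Q' t"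
    unfolding mop_Suc
    using has_poly_deriv_diff[OF has_poly_deriv_diff[OF has_poly_deriv_pCons[OF Q] has_poly_deriv_smult[OF _ Q]] V]
    by blast
  obtain k' where k': "((\<lambda>s. mnorm (F s) (Suc n)) has_real_derivative k') (at t)"
    unfolding mnorm_def using F_diagonal_deriv[OF t has_poly_deriv_mult[OF Q' Q']] by blast
  obtain \<beta>' where "((\<lambda>s. mbeta (F s) (Suc n)) has_real_derivative \<beta>') (at t)"
    unfolding mbeta_Suc using DERIV_divide[OF k' h' nz] by blast
  then have "\<exists>V. has_poly_deriv (\<lambda>s. mopG (F s) (Suc n)) V t"
    unfolding mopG_Suc using has_poly_deriv_smult[OF _ Q] by blast
  then show ?case using Q' by blast
qed

text \<open>The difference of the two sides has degree below \<open>n\<close>. Against lower-degree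
  \<open>q\<close>, the differentiated orthogonality relation supplies the boundary term that
  cancels the one in \<open>stein_mop_mult\<close>, and \<open>L_mopG\<close> accounts for the
  rest.\<close>

lemma mop_dilation_deriv:
  assumes t: "t > 0"
  obtains Q where "has_poly_deriv (\<lambda>s. mop (F s) n) Q t" "deg_lt Q n"
    "pCons 0 (pderiv (mop (F t) n)) + smult t Q = smult (real n) (mop (F t) n) + mopG (F t) n"
proof -
  interpret stein_functional "F t" a t "\<kappa> t" by (rule stein_functional[OF t])
  obtain Q where Q: "has_poly_deriv (\<lambda>s. mop (F s) n) Q t"
    using mop_differentiable[OF t] by blast
  have low: "deg_lt Q n"
    unfolding deg_lt_def
  proof (intro allI impI)
    fix i assume i: "n \<le> i"
    have "((\<lambda>s. coeff (mop (F s) n) i) has_real_derivative coeff Q i) (at t)"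
      using Q by (simp add: has_poly_deriv_def)
    \<comment> \<open>Monic of fixed degree, so these coefficients do not depend on
      \<open>s\<close>.\<close>
    moreover have "(\<lambda>s. coeff (mop (F s) n) i) = (\<lambda>s. if i = n then 1 else 0)"
      using i by (auto simp: coeff_eq_0)
    ultimately show "coeff Q i = 0" using DERIV_unique[OF _ DERIV_const] by metis
  qed
  let ?D = "pCons 0 (pderiv (mop (F t) n)) + smult t Q - (smult (real n) (mop (F t) n) + mopG (F t) n)"
  have "?D = 0"
  proof (rule orth_eq_0)
    have "deg_lt (pCons 0 (pderiv (mop (F t) n)) - smult (real n) (mop (F t) n)) n"
      unfolding deg_lt_def
    proof (intro allI impI)
      fix i assume "n \<le> i"
      then show "coeff (pCons 0 (pderiv (mop (F t) n)) - smult (real n) (mop (F t) n)) i = 0"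
        by (cases "i = n") (simp_all add: coeff_X_pderiv coeff_eq_0)
    qed
    from deg_lt_diff[OF deg_lt_add[OF this deg_lt_smult[OF low, of t]] deg_lt_mopG]
    show "deg_lt ?D n" by (simp add: algebra_simps)
  next
    fix q :: "real poly" assume q: "deg_lt q n"
    have "((\<lambda>s. F s (mop (F s) n * q)) has_real_derivative
        F t (Q * q) - \<kappa> t * poly (mop (F t) n * q) t) (at t)"
      using F_diagonal_deriv[OF t has_poly_deriv_mult[OF Q has_poly_deriv_const[of q]]] by simp
    moreover have "\<forall>\<^sub>F s in nhds t. F s (mop (F s) n * q) = 0"
      using eventually_pos[OF t]
      by eventually_elim (rule pos_functional.mop_orth[OF pos_functional q])
    ultimately have "((\<lambda>s. 0) has_real_derivative F t (Q * q) - \<kappa> t * poly (mop (F t) n * q) t) (at t)"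
      by (subst (asm) DERIV_cong_ev[OF refl _ refl])
    then have Qq: "F t (Q * q) = \<kappa> t * poly (mop (F t) n) t * poly q t"
      using DERIV_unique[OF _ DERIV_const] by fastforce
    have "F t (?D * q) = F t (pCons 0 (pderiv (mop (F t) n)) * q) + t * F t (Q * q)
        - (real n * F t (mop (F t) n * q) + F t (mopG (F t) n * q))"
      by (simp only: left_diff_distrib distrib_right mult_smult_left L_linear)
    then show "F t (?D * q) = 0"
      using stein_mop_mult[OF q] mop_orth[OF q] L_mopG[OF q] Qq by simp
  qed
  then show thesis using that[OF Q low] by (simp add: algebra_simps)
qed

text \<open>On the diagonal the total derivative is the dilation operator divided by
  \<open>t\<close>.\<close>

lemma poly_mop_deriv:
  assumes t: "t > 0"
  shows "((\<lambda>s. poly (mop (F s) n) s) has_real_derivative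
    (real n * poly (mop (F t) n) t + poly (mopG (F t) n) t) / t) (at t)"
proof -
  obtain Q where Q: "has_poly_deriv (\<lambda>s. mop (F s) n) Q t"
    and eq: "pCons 0 (pderiv (mop (F t) n)) + smult t Q = smult (real n) (mop (F t) n) + mopG (F t) n"
    using mop_dilation_deriv[OF t] by metis
  have "t * (poly (pderiv (mop (F t) n)) t + poly Q t) = real n * poly (mop (F t) n) t + poly (mopG (F t) n) t"
    using arg_cong[OF eq, of "\<lambda>p. poly p t"] by (simp add: algebra_simps)
  then have "poly (pderiv (mop (F t) n)) t + poly Q t
      = (real n * poly (mop (F t) n) t + poly (mopG (F t) n) t) / t"
    using t by (simp add: field_simps)
  then show ?thesis
    using poly_diagonal_has_derivative[OF Q] by simp
qed

text \<open>The parameter derivative \<open>Q\<close> has lower degree, hence is orthogonal to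
  \<open>mop (F t) n\<close>; only the boundary term survives.\<close>

lemma mnorm_deriv:
  assumes t: "t > 0"
  shows "((\<lambda>s. mnorm (F s) n) has_real_derivative - (\<kappa> t * (poly (mop (F t) n) t)\<^sup>2)) (at t)"
proof -
  interpret stein_functional "F t" a t "\<kappa> t" by (rule stein_functional[OF t])
  obtain Q where Q: "has_poly_deriv (\<lambda>s. mop (F s) n) Q t" and low: "deg_lt Q n"
    using mop_dilation_deriv[OF t] by metis
  have "F t (Q * mop (F t) n + mop (F t) n * Q) = 0"
    using mop_orth[OF low] unfolding L_add by (simp add: mult.commute)
  then show ?thesis
    using F_diagonal_deriv[OF t has_poly_deriv_mult[OF Q Q]]
    by (simp add: mnorm_def power2_eq_square)
qed

lemma auxR_deriv:
  assumes t: "t > 0"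
  shows "((\<lambda>s. auxR (F s) (\<kappa> s) s n) has_real_derivative
    ((a - t + 2 * real n + t * auxR (F t) (\<kappa> t) t n) * auxR (F t) (\<kappa> t) t n
      + 2 * auxr (F t) (\<kappa> t) t n) / t) (at t)"
proof -
  interpret stein_functional "F t" a t "\<kappa> t" by (rule stein_functional[OF t])
  have "mnorm (F t) n \<noteq> 0" using mnorm_pos[of n] by simp
  then show ?thesis
    using t unfolding auxR_def auxr_def
    by (auto intro!: derivative_eq_intros kappa_deriv poly_mop_deriv mnorm_deriv
        simp: field_simps power2_eq_square)
qed

text \<open>For \<open>n = Suc m\<close> the factor \<open>\<beta>\<^sub>n / h\<^sub>n\<close>
  equals \<open>1 / h\<^sub>m\<close>, which avoids differentiating
  \<open>\<beta>\<^sub>n\<close>.\<close>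

lemma auxr_deriv:
  assumes t: "t > 0"
  shows "((\<lambda>s. auxr (F s) (\<kappa> s) s n) has_real_derivative
    (auxX (F t) (\<kappa> t) t n - mbeta (F t) n * auxR (F t) (\<kappa> t) t n) / t) (at t)"
proof (cases n)
  case 0
  then show ?thesis by (simp add: auxr_def auxX_def)
next
  case (Suc m)
  interpret stein_functional "F t" a t "\<kappa> t" by (rule stein_functional[OF t])
  define p p1 g h where "p = poly (mop (F t) m) t" and "p1 = poly (mop (F t) n) t"
    and "g = poly (mopG (F t) m) t" and "h = mnorm (F t) m"
  have h: "h \<noteq> 0" using mnorm_pos[of m] by (simp add: h_def)
  have hn: "mnorm (F t) n \<noteq> 0" using mnorm_pos[of n] by simp
  \<comment> \<open>With this value of \<open>g\<close>, from the recurrence and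
    \<open>alpha_eq\<close>, all terms containing \<open>p1 * p\<close> cancel.\<close>
  have g: "g = (t - (2 * real m + 1 + a + t * (\<kappa> t * p\<^sup>2 / h))) * p - p1"
    using poly_mop_Suc[of m] alpha_eq[of m] by (simp add: g_def p_def p1_def h_def Suc auxR_def)
  have "((\<lambda>s. \<kappa> s * poly (mop (F s) n) s * poly (mop (F s) m) s / mnorm (F s) m) has_real_derivative
    ((\<kappa> t * (a / t - 1) * p1 * p + \<kappa> t * ((real n * p1 + mbeta (F t) n * p) / t) * p
      + \<kappa> t * p1 * ((real m * p + g) / t)) * h + \<kappa> t * p1 * p * (\<kappa> t * p\<^sup>2)) / (h * h)) (at t)"
    using t h unfolding p_def p1_def g_def h_def
    by (auto intro!: derivative_eq_intros kappa_deriv poly_mop_deriv mnorm_deriv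
        simp: Suc poly_mopG_Suc algebra_simps)
  also have "((\<kappa> t * (a / t - 1) * p1 * p + \<kappa> t * ((real n * p1 + mbeta (F t) n * p) / t) * p
      + \<kappa> t * p1 * ((real m * p + g) / t)) * h + \<kappa> t * p1 * p * (\<kappa> t * p\<^sup>2)) / (h * h)
     = (\<kappa> t * mbeta (F t) n * p\<^sup>2 / h - \<kappa> t * p1\<^sup>2 / h) / t"
    unfolding g using t h Suc by (simp add: field_simps power2_eq_square)
  also have "\<kappa> t * mbeta (F t) n * p\<^sup>2 / h = auxX (F t) (\<kappa> t) t n"
    using h hn by (simp add: auxX_def Suc poly_mopG_Suc mbeta_Suc p_def h_def power2_eq_square)
  also have "\<kappa> t * p1\<^sup>2 / h = mbeta (F t) n * auxR (F t) (\<kappa> t) t n"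
    using h hn by (simp add: auxR_def Suc mbeta_Suc p1_def h_def)
  finally have D: "((\<lambda>s. \<kappa> s * poly (mop (F s) n) s * poly (mop (F s) m) s / mnorm (F s) m) has_real_derivative
     (auxX (F t) (\<kappa> t) t n - mbeta (F t) n * auxR (F t) (\<kappa> t) t n) / t) (at t)" .
  have "\<forall>\<^sub>F s in nhds t. auxr (F s) (\<kappa> s) s n
      = \<kappa> s * poly (mop (F s) n) s * poly (mop (F s) m) s / mnorm (F s) m"
    using eventually_pos[OF t]
  proof eventually_elim
    case (elim s)
    have "mnorm (F s) n > 0" by (rule pos_functional.mnorm_pos[OF pos_functional[OF elim]])
    then show ?case by (simp add: auxr_def Suc mopG_Suc mbeta_Suc)
  qed
  then show ?thesis using D by (subst DERIV_cong_ev[OF refl _ refl])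
qed

end

section \<open>The Painleve equation\<close>

text \<open>On the left \<open>b\<close> occurs only through \<open>b * (1 - R)\<close>, which the
  first integral replaces; the rest is a polynomial identity.\<close>

lemma painleve_identity:
  fixes a N R u t b :: real
  defines "e \<equiv> a - t + 2 * N + t * R + 2 * u"
  assumes "N * (N + a) + (2 * N + a) * (u * R) + u\<^sup>2 * R = b * (1 - R)"
  shows "2 * (R - 1) * (- t + t * R + t * e * R + 2 * u\<^sup>2 - 2 * b - 2 * u * e - e\<^sup>2)
    = - (2 * R - 3) * e\<^sup>2 - a\<^sup>2 + 2 * (2 * N + 1 + a) * t * (R - 1)\<^sup>2 + t\<^sup>2 * (R - 1)\<^sup>2 * (2 * R - 1)"
proof -
  have "2 * (R - 1) * (- t + t * R + t * e * R + 2 * u\<^sup>2 - 2 * b - 2 * u * e - e\<^sup>2)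
    = 2 * (R - 1) * (- t + t * R + t * e * R + 2 * u\<^sup>2 - 2 * u * e - e\<^sup>2) + 4 * (b * (1 - R))"
    by (simp add: algebra_simps)
  also have "\<dots> = - (2 * R - 3) * e\<^sup>2 - a\<^sup>2 + 2 * (2 * N + 1 + a) * t * (R - 1)\<^sup>2 + t\<^sup>2 * (R - 1)\<^sup>2 * (2 * R - 1)"
    unfolding assms(2)[symmetric] e_def by (simp add: algebra_simps power2_eq_square)
  finally show ?thesis .
qed

text \<open>The equation for \<open>R\<close> is assumed at all positive \<open>s\<close>, since the
  formula for \<open>deriv S\<close> must hold near \<open>t\<close> before it is differentiated
  again; \<open>r\<close> needs its derivative at \<open>t\<close> only.\<close>

lemma painleve_of_system:
  fixes R r S :: "real \<Rightarrow> real" and a N X b t :: real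
  assumes t: "t > 0"
    and R': "\<And>s. s > 0 \<Longrightarrow>
      (R has_real_derivative ((a - s + 2 * N + s * R s) * R s + 2 * r s) / s) (at s)"
    and r': "(r has_real_derivative (X - b * R t) / t) (at t)"
    and X: "X * R t = (r t)\<^sup>2"
    and integral: "N * (N + a) + (2 * N + a) * r t + X = b * (1 - R t)"
    and R0: "R t \<noteq> 0" and R1: "R t \<noteq> 1"
    and S: "\<And>s. s > 0 \<Longrightarrow> S s = 1 - 1 / R s"
  shows "(S has_real_derivative deriv S t) (at t)"
    and "(deriv S has_real_derivative deriv (deriv S) t) (at t)"
    and "deriv (deriv S) t = (3 * S t - 1) / (2 * S t * (S t - 1)) * (deriv S t)\<^sup>2 - deriv S t / t
           - a\<^sup>2 / 2 * (S t - 1)\<^sup>2 / (t\<^sup>2 * S t) + (2 * N + 1 + a) * S t / t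
           - 1 / 2 * (S t * (S t + 1)) / (S t - 1)"
proof -
  \<comment> \<open>In the application this is \<open>G\<^sub>n(t) / P\<^sub>n(t)\<close>; it
    rationalises \<open>X R = r\<^sup>2\<close>.\<close>
  define u where "u s = r s / R s" for s
  \<comment> \<open>\<open>e = t R' / R\<close> is affine in \<open>R\<close> and \<open>u\<close>.\<close>
  define e where "e s = a - s + 2 * N + s * R s + 2 * u s" for s
  have R'e: "(R has_real_derivative e s * R s / s) (at s)" if "s > 0" "R s \<noteq> 0" for s
    using R'[OF that(1)] that by (simp add: e_def u_def algebra_simps)
  have S': "(S has_real_derivative e s / (s * R s)) (at s)" if "s > 0" "R s \<noteq> 0" for s
  proof -
    have "((\<lambda>s. 1 - 1 / R s) has_real_derivative e s / (s * R s)) (at s)"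
      using that by (auto intro!: derivative_eq_intros R'e simp: field_simps power2_eq_square)
    moreover have "\<forall>\<^sub>F s in nhds s. S s = 1 - 1 / R s"
      using eventually_nhds_in_open[of "{0<..}" s] that(1) by (auto elim!: eventually_mono intro: S)
    ultimately show ?thesis by (subst DERIV_cong_ev[OF refl _ refl])
  qed
  have dS: "deriv S t = e t / (t * R t)"
    by (rule DERIV_imp_deriv[OF S'[OF t R0]])
  show "(S has_real_derivative deriv S t) (at t)"
    unfolding dS by (rule S'[OF t R0])
  have X': "X = (u t)\<^sup>2 * R t" using X R0 by (simp add: u_def field_simps power2_eq_square)
  have u': "(u has_real_derivative ((u t)\<^sup>2 - b - u t * e t) / t) (at t)"
    unfolding u_def[abs_def]
    by (rule derivative_eq_intros r' R'e t R0 refl)+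
       (use t R0 in \<open>simp add: X' u_def field_simps power2_eq_square\<close>)
  \<comment> \<open>\<open>K\<close> is \<open>t e' - e\<^sup>2\<close>, the combination occurring
    in the second derivative of \<open>S\<close>.\<close>
  define K where "K = - t + t * R t + t * e t * R t + 2 * (u t)\<^sup>2 - 2 * b - 2 * u t * e t - (e t)\<^sup>2"
  have e': "(e has_real_derivative (K + (e t)\<^sup>2) / t) (at t)"
    unfolding e_def[abs_def]
    by (rule derivative_eq_intros u' R'e t R0 refl)+
       (use t R0 in \<open>simp add: K_def e_def field_simps power2_eq_square\<close>)
  have ddS': "((\<lambda>s. e s / (s * R s)) has_real_derivative (K - e t) / (t\<^sup>2 * R t)) (at t)"
    by (rule derivative_eq_intros e' R'e t R0 refl)+
       (use t R0 in \<open>simp_all add: field_simps power2_eq_square\<close>)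
  \<comment> \<open>By continuity \<open>R\<close> stays nonzero near \<open>t\<close>, so the
    formula for \<open>deriv S\<close> holds in a neighbourhood.\<close>
  have "isCont R t" using R'e[OF t R0] by (rule DERIV_isCont)
  then have "\<forall>\<^sub>F s in nhds t. R s \<noteq> 0"
    using R0 tendsto_imp_eventually_ne[of R "R t" "at t" 0] by (simp add: isCont_def eventually_nhds_conv_at)
  moreover have "\<forall>\<^sub>F s in nhds t. s > 0"
    using eventually_nhds_in_open[of "{0<..}" t] t by simp
  ultimately have "\<forall>\<^sub>F s in nhds t. deriv S s = e s / (s * R s)"
    by eventually_elim (rule DERIV_imp_deriv[OF S'])
  then have ddS: "(deriv S has_real_derivative (K - e t) / (t\<^sup>2 * R t)) (at t)"
    using ddS' by (subst DERIV_cong_ev[OF refl _ refl])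
  then show "(deriv S has_real_derivative deriv (deriv S) t) (at t)"
    using DERIV_imp_deriv by metis
  have ddSt: "deriv (deriv S) t = (K - e t) / (t\<^sup>2 * R t)"
    by (rule DERIV_imp_deriv[OF ddS])
  have r: "r t = u t * R t" using R0 by (simp add: u_def)
  have key: "2 * (R t - 1) * K = - (2 * R t - 3) * (e t)\<^sup>2 - a\<^sup>2
      + 2 * (2 * N + 1 + a) * t * (R t - 1)\<^sup>2 + t\<^sup>2 * (R t - 1)\<^sup>2 * (2 * R t - 1)"
    using painleve_identity[of N a "u t" "R t" b t] integral unfolding K_def e_def r X' by simp
  define \<rho> \<epsilon> where "\<rho> = R t" and "\<epsilon> = e t"
  have nz: "\<rho> \<noteq> 0" "\<rho> - 1 \<noteq> 0" "t \<noteq> 0" using R0 R1 t by (auto simp: \<rho>_def)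
  have St: "S t = (\<rho> - 1) / \<rho>" "S t - 1 = - 1 / \<rho>" "S t + 1 = (2 * \<rho> - 1) / \<rho>" "3 * S t - 1 = (2 * \<rho> - 3) / \<rho>"
    using S[OF t] nz by (simp_all add: \<rho>_def field_simps)
  have K: "K = (- (2 * \<rho> - 3) * \<epsilon>\<^sup>2 - a\<^sup>2) / (2 * (\<rho> - 1))
      + (2 * N + 1 + a) * t * (\<rho> - 1) + t\<^sup>2 * (\<rho> - 1) * (2 * \<rho> - 1) / 2"
    using key nz unfolding \<rho>_def[symmetric] \<epsilon>_def[symmetric]
    by (simp add: field_simps power2_eq_square)
  \<comment> \<open>Each term of the equation is brought over the denominator
    \<open>t\<^sup>2 * \<rho>\<close>, so that the numerators add up to
    \<open>K - \<epsilon>\<close>.\<close>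
  have 1: "(3 * S t - 1) / (2 * S t * (S t - 1)) * (deriv S t)\<^sup>2 = - (2 * \<rho> - 3) * \<epsilon>\<^sup>2 / (2 * (\<rho> - 1)) / (t\<^sup>2 * \<rho>)"
    unfolding St(2,4) unfolding St(1) dS \<rho>_def[symmetric] \<epsilon>_def[symmetric]
    using nz by (simp add: divide_simps power2_eq_square) (simp add: algebra_simps)
  have 2: "deriv S t / t = \<epsilon> / (t\<^sup>2 * \<rho>)"
    unfolding dS \<rho>_def \<epsilon>_def by (simp add: power2_eq_square)
  have 3: "a\<^sup>2 / 2 * (S t - 1)\<^sup>2 / (t\<^sup>2 * S t) = a\<^sup>2 / (2 * (\<rho> - 1)) / (t\<^sup>2 * \<rho>)"
    unfolding St(2) unfolding St(1) using nz by (simp add: divide_simps power2_eq_square)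
  have 4: "(2 * N + 1 + a) * S t / t = (2 * N + 1 + a) * t * (\<rho> - 1) / (t\<^sup>2 * \<rho>)"
    unfolding St(1) using nz by (simp add: divide_simps power2_eq_square)
  have 5: "1 / 2 * (S t * (S t + 1)) / (S t - 1) = - (t\<^sup>2 * (\<rho> - 1) * (2 * \<rho> - 1) / 2) / (t\<^sup>2 * \<rho>)"
    unfolding St(2,3) unfolding St(1) using nz by (simp add: divide_simps power2_eq_square)
  show "deriv (deriv S) t = (3 * S t - 1) / (2 * S t * (S t - 1)) * (deriv S t)\<^sup>2 - deriv S t / t
           - a\<^sup>2 / 2 * (S t - 1)\<^sup>2 / (t\<^sup>2 * S t) + (2 * N + 1 + a) * S t / t
           - 1 / 2 * (S t * (S t + 1)) / (S t - 1)"
    unfolding 1 2 3 4 5 ddSt \<rho>_def[symmetric] \<epsilon>_def[symmetric] K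
    by (simp add: add_divide_distrib diff_divide_distrib)
qed

section \<open>Identification of the given definitions with the recursive construction\<close>

lemma OP_eq_mop:
  assumes "a > 0" "A \<ge> 0" "B > 0" "t > 0"
  shows "OP a A B t n = mop (jump_functional a A B t) n"
proof -
  interpret stein_functional "jump_functional a A B t" a t "jump a B t"
    by (rule stein_functional_jump_functional[OF assms])
  show ?thesis
    unfolding OP_def
  proof (rule the_equality)
    show "is_monic_OP a A B t n (mop (jump_functional a A B t) n)"
      using mop_orth[OF deg_lt_monom]
      by (simp add: is_monic_OP_def ip_eq_jump_functional assms)
    show "p = mop (jump_functional a A B t) n" if "is_monic_OP a A B t n p" for p
      using that by (intro mop_unique) (auto simp: is_monic_OP_def ip_eq_jump_functional assms)
  qed
qed

lemma alphan_eq_malpha: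
  assumes "a > 0" "A \<ge> 0" "B > 0" "t > 0" "n \<ge> 1"
  shows "alphan a A B n t = malpha (jump_functional a A B t) n"
proof -
  let ?L = "jump_functional a A B t"
  interpret stein_functional ?L a t "jump a B t"
    by (rule stein_functional_jump_functional[OF assms(1-4)])
  have OP: "OP a A B t m = mop ?L m" for m by (rule OP_eq_mop[OF assms(1-4)])
  have "mopG ?L n = smult (mbeta ?L n) (mop ?L (n - 1))"
    using mopG_Suc[of ?L "n - 1"] assms(5) by simp
  then have "[:0, 1:] * mop ?L n = mop ?L (Suc n) + smult (malpha ?L n) (mop ?L n)
      + smult (mbeta ?L n) (mop ?L (n - 1))"
    by (simp add: mop_Suc)
  then show ?thesis
    unfolding alphan_def OP by (intro the_equality) (auto intro: three_term_coeff assms(5))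
qed

lemma Rn_eq_auxR:
  assumes "a > 0" "A \<ge> 0" "B > 0" "t > 0"
  shows "Rn a A B n t = auxR (jump_functional a A B t) (jump a B t) t n"
  by (simp add: Rn_def hn_def OP_eq_mop ip_eq_jump_functional assms auxR_def mnorm_def jump_def)

lemma stein_family_jump_functional:
  assumes "a > 0" "A \<ge> 0" "B > 0"
  shows "stein_family (jump_functional a A B) a (jump a B)"
proof (rule stein_family.intro)
  show "stein_functional (jump_functional a A B t) a t (jump a B t)" if "t > 0" for t
    by (rule stein_functional_jump_functional[OF assms that])
  show "((\<lambda>s. jump_functional a A B s p) has_real_derivative - (jump a B t * poly p t)) (at t)"
    if "t > 0" for t p
    by (rule jump_functional_has_derivative[OF assms(1) that])
  show "(jump a B has_real_derivative jump a B t * (a / t - 1)) (at t)" if "t > 0" for t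
    unfolding jump_def[abs_def] using that
    by (auto intro!: derivative_eq_intros simp: powr_diff field_simps)
qed

text \<open>The differentiability clauses give \<open>deriv\<close> its meaning; the last two
  hypotheses keep \<open>1 / Rn\<close> and the divisions by \<open>S\<close> from being divisions
  by zero.\<close>

theorem theorem5:
  fixes a A B t :: real and n :: nat
  assumes "a > 0" and "A \<ge> 0" and "B > 0" and "n \<ge> 1" and "t > 0"
    and "Rn a A B n t \<noteq> 0" and "Sn a A B n t \<noteq> 0"
  shows "(Sn a A B n has_real_derivative deriv (Sn a A B n) t) (at t)
       \<and> (deriv (Sn a A B n) has_real_derivative deriv (deriv (Sn a A B n)) t) (at t)
       \<and> (let S = Sn a A B n t; S' = deriv (Sn a A B n) t; S'' = deriv (deriv (Sn a A B n)) t in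
            S'' = (3 * S - 1) / (2 * S * (S - 1)) * S'\<^sup>2 - S' / t
                  - a\<^sup>2 / 2 * (S - 1)\<^sup>2 / (t\<^sup>2 * S)
                  + (2 * real n + 1 + a) * S / t
                  - 1 / 2 * (S * (S + 1)) / (S - 1))
       \<and> Sn a A B n t = (alphan a A B n t - (2 * real n + a + 1) - t) / (alphan a A B n t - (2 * real n + a + 1))"
proof -
  let ?L = "jump_functional a A B" and ?k = "jump a B"
  interpret stein_family ?L a ?k by (rule stein_family_jump_functional[OF assms(1-3)])
  interpret stein_functional "?L t" a t "?k t" by (rule stein_functional[OF assms(5)])
  have Rn: "Rn a A B n s = auxR (?L s) (?k s) s n" if "s > 0" for s
    by (rule Rn_eq_auxR[OF assms(1-3) that])
  \<comment> \<open>\<open>R = 1\<close> is excluded because \<open>1 - 1 / R\<close> is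
    nonzero.\<close>
  have R0: "auxR (?L t) (?k t) t n \<noteq> 0" and R1: "auxR (?L t) (?k t) t n \<noteq> 1"
    using assms(6,7) Rn[OF assms(5)] by (auto simp: Sn_def)
  have S: "Sn a A B n s = 1 - 1 / auxR (?L s) (?k s) s n" if "s > 0" for s
    by (simp add: Sn_def Rn[OF that])
  note PV = painleve_of_system[OF assms(5) auxR_deriv auxr_deriv[OF assms(5)] X_R
      first_integral R0 R1 S]
  have "alphan a A B n t - (2 * real n + a + 1) = t * auxR (?L t) (?k t) t n"
    using alpha_eq[of n] unfolding alphan_eq_malpha[OF assms(1-3,5,4)] by simp
  \<comment> \<open>Expanding the fraction by \<open>t\<close> brings in \<open>t R\<close>, which
    is the shifted \<open>alphan\<close>.\<close>
  moreover have "Sn a A B n t = (t * auxR (?L t) (?k t) t n - t) / (t * auxR (?L t) (?k t) t n)"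
    unfolding S[OF assms(5)] using R0 assms(5) by (simp add: field_simps)
  ultimately have "Sn a A B n t
      = (alphan a A B n t - (2 * real n + a + 1) - t) / (alphan a A B n t - (2 * real n + a + 1))"
    by (simp only:)
  then show ?thesis using PV by (simp only: Let_def simp_thms)
qed

end
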